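(* Let $\alpha\in\mathbb C\setminus(-\mathbb N)$, where $-\mathbb N=\{-1,-2,-3,\dots\}$. Then for all $m,n\in\mathbb N_0$, $$\mathrm{gen}\!\int_0^\infty L_m^\alpha(z)\,L_n^\alpha(z)\,z^\alpha e^{-z}\,dz=\frac{\Gamma(1+n+\alpha)}{n!}\,\delta_{m,n}.$$
   Context: Laguerre polynomials: for $\alpha\in\mathbb C$ and $n\in\mathbb N_0$, $$L_n^\alpha(z):=\frac1{n!}e^zz^{-\alpha}\partial_z^n\big(e^{-z}z^{n+\alpha}\big)=(-1)^n\sum_{k=0}^n\frac{(-\alpha-n)_{n-k}\,z^k}{k!\,(n-k)!},$$ where $(a)_k=a(a+1)\cdots(a+k-1)$. $\delta_{m,n}$ is the Kronecker delta. Generalized integral: a function $f$ on $]0,\infty[$ is integrable in the generalized sense if it is integrable on $]1,\infty[$ and there exist a finite set $\Omega\subset\mathbb C$ and complex coefficients $(f_k)_{k\in\Omega}$ such that $f-\sum_{k\in\Omega}f_kr^k$ is integrable on $]0,1[$. For such $f$, $$\mathrm{gen}\!\int_0^\infty f(r)\,dr:=\sum_{k\in\Omega\setminus\{-1\}}\frac{f_k}{k+1}+\int_0^1\Big(f(r)-\sum_{k\in\Omega}f_kr^k\Big)dr+\int_1^\infty f(r)\,dr,$$ which does not depend on the choice of $\Omega$. *)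

theory Defs
  imports "HOL-Complex_Analysis.Complex_Analysis"
begin

text \<open>The Laguerre polynomials are defined by their explicit sum, which makes sense for every
  complex argument. The Rodrigues formula needs a branch of \<open>z powr \<alpha>\<close>; it is proved below
  as \<open>Laguerre_Rodrigues\<close> on the slit plane.\<close>

definition Laguerre :: "complex \<Rightarrow> nat \<Rightarrow> complex \<Rightarrow> complex" where
  "Laguerre \<alpha> n z =
     (-1) ^ n * (\<Sum>k=0..n. pochhammer (- \<alpha> - of_nat n) (n - k) * z ^ k / (fact k * fact (n - k)))"

lemma higher_deriv_powr_slit:
  fixes a z :: complex
  assumes "z \<notin> \<real>\<^sub>\<le>\<^sub>0"
  shows "(deriv ^^ k) (\<lambda>w. w powr a) z = (-1) ^ k * pochhammer (- a) k * z powr (a - of_nat k)"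
  using assms
proof (induction k arbitrary: z)
  case 0
  then show ?case by simp
next
  case (Suc k)
  have ev: "\<forall>\<^sub>F w in nhds z. (deriv ^^ k) (\<lambda>w. w powr a) w =
              (-1) ^ k * pochhammer (- a) k * w powr (a - of_nat k)"
    using eventually_nhds_in_open[of "- \<real>\<^sub>\<le>\<^sub>0" z] Suc.prems
    by (auto elim!: eventually_mono simp: Suc.IH open_Compl)
  have "((\<lambda>w. (-1) ^ k * pochhammer (- a) k * w powr (a - of_nat k)) has_field_derivative
          (-1) ^ k * pochhammer (- a) k * ((a - of_nat k) * z powr (a - of_nat k - 1))) (at z)"
    using Suc.prems by (intro DERIV_cmult has_field_derivative_powr)
  then have "deriv ((deriv ^^ k) (\<lambda>w. w powr a)) z =
          (-1) ^ k * pochhammer (- a) k * ((a - of_nat k) * z powr (a - of_nat k - 1))"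
    using deriv_cong_ev[OF ev refl] DERIV_imp_deriv by metis
  also have "\<dots> = (-1) ^ Suc k * pochhammer (- a) (Suc k) * z powr (a - of_nat (Suc k))"
    by (simp add: pochhammer_rec' algebra_simps)
  finally show ?case by simp
qed

lemma higher_deriv_exp_minus: "(deriv ^^ k) (\<lambda>w::complex. exp (- w)) = (\<lambda>w. (-1) ^ k * exp (- w))"
proof (induction k)
  case (Suc k)
  have "deriv (\<lambda>w::complex. (-1) ^ k * exp (- w)) z = (-1) ^ Suc k * exp (- z)" for z
    by (rule DERIV_imp_deriv) (auto intro!: derivative_eq_intros)
  then show ?case by (simp add: Suc.IH fun_eq_iff)
qed simp

lemma Laguerre_Rodrigues:
  assumes z: "z \<notin> \<real>\<^sub>\<le>\<^sub>0"
  shows "Laguerre \<alpha> n z = 1 / fact n * exp z * z powr (- \<alpha>) *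
           (deriv ^^ n) (\<lambda>w. exp (- w) * w powr (of_nat n + \<alpha>)) z"
proof -
  have z0: "z \<noteq> 0" using z by auto
  have "(deriv ^^ n) (\<lambda>w. exp (- w) * w powr (of_nat n + \<alpha>)) z =
     (\<Sum>i=0..n. of_nat (n choose i) * (deriv ^^ i) (\<lambda>w. exp (- w)) z *
        (deriv ^^ (n - i)) (\<lambda>w. w powr (of_nat n + \<alpha>)) z)"
    using z by (intro higher_deriv_mult[of _ "- \<real>\<^sub>\<le>\<^sub>0"])
      (auto intro!: holomorphic_intros)
  also have "\<dots> = (\<Sum>i=0..n. of_nat (n choose i) * ((-1) ^ i * exp (- z)) *
        ((-1) ^ (n - i) * pochhammer (- \<alpha> - of_nat n) (n - i) * (z powr \<alpha> * z ^ i)))"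
  proof (intro sum.cong refl)
    fix i assume "i \<in> {0..n}"
    then have e: "of_nat n + \<alpha> - of_nat (n - i) = \<alpha> + of_nat i" by (simp add: of_nat_diff)
    have m: "- (of_nat n :: complex) - \<alpha> = - \<alpha> - of_nat n" by simp
    have "z powr (\<alpha> + of_nat i) = z powr \<alpha> * z ^ i"
      using z0 by (simp add: powr_add powr_nat)
    then show "of_nat (n choose i) * (deriv ^^ i) (\<lambda>w. exp (- w)) z *
        (deriv ^^ (n - i)) (\<lambda>w. w powr (of_nat n + \<alpha>)) z =
      of_nat (n choose i) * ((-1) ^ i * exp (- z)) *
        ((-1) ^ (n - i) * pochhammer (- \<alpha> - of_nat n) (n - i) * (z powr \<alpha> * z ^ i))"
      by (simp add: higher_deriv_exp_minus higher_deriv_powr_slit[OF z] e m)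
  qed
  also have "1 / fact n * exp z * z powr (- \<alpha>) * \<dots> = Laguerre \<alpha> n z"
    unfolding Laguerre_def sum_distrib_left
  proof (intro sum.cong refl)
    fix i assume i: "i \<in> {0..n}"
    have b: "of_nat (n choose i) = (fact n / (fact i * fact (n - i)) :: complex)"
      using i by (simp add: binomial_fact)
    have s: "(-1) ^ i * (-1) ^ (n - i) = ((-1) ^ n :: complex)"
      using i by (simp flip: power_add)
    have c: "exp z * exp (- z) = 1" "z powr (- \<alpha>) * z powr \<alpha> = 1"
      using z0 by (simp_all flip: exp_add powr_add)
    have "1 / fact n * exp z * z powr (- \<alpha>) * (of_nat (n choose i) * ((-1) ^ i * exp (- z)) *
        ((-1) ^ (n - i) * pochhammer (- \<alpha> - of_nat n) (n - i) * (z powr \<alpha> * z ^ i))) =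
      1 / fact n * of_nat (n choose i) * (exp z * exp (- z)) * (z powr (- \<alpha>) * z powr \<alpha>) *
        ((-1) ^ i * (-1) ^ (n - i)) * pochhammer (- \<alpha> - of_nat n) (n - i) * z ^ i"
      by (simp only: mult_ac)
    then show "1 / fact n * exp z * z powr (- \<alpha>) * (of_nat (n choose i) * ((-1) ^ i * exp (- z)) *
        ((-1) ^ (n - i) * pochhammer (- \<alpha> - of_nat n) (n - i) * (z powr \<alpha> * z ^ i))) =
      (-1) ^ n * (pochhammer (- \<alpha> - of_nat n) (n - i) * z ^ i / (fact i * fact (n - i)))"
      unfolding c s b by simp
  qed
  finally show ?thesis by simp
qed

definition singular_part :: "complex set \<Rightarrow> (complex \<Rightarrow> complex) \<Rightarrow> real \<Rightarrow> complex" where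
  "singular_part \<Omega> c r = (\<Sum>k\<in>\<Omega>. c k * complex_of_real r powr k)"

definition gen_expansion :: "(real \<Rightarrow> complex) \<Rightarrow> complex set \<Rightarrow> (complex \<Rightarrow> complex) \<Rightarrow> bool" where
  "gen_expansion f \<Omega> c \<longleftrightarrow>
     finite \<Omega> \<and> set_integrable lebesgue {0<..<1} (\<lambda>r. f r - singular_part \<Omega> c r)"

definition gen_integrable :: "(real \<Rightarrow> complex) \<Rightarrow> bool" where
  "gen_integrable f \<longleftrightarrow> set_integrable lebesgue {1<..} f \<and> (\<exists>\<Omega> c. gen_expansion f \<Omega> c)"

text \<open>The value does not depend on the choice of the expansion, so the definite description is
  meaningful for every \<open>f\<close> with \<open>gen_integrable f\<close>; for other \<open>f\<close> it carries no information.\<close>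

definition gen_integral :: "(real \<Rightarrow> complex) \<Rightarrow> complex" where
  "gen_integral f = (THE I. \<exists>\<Omega> c. gen_expansion f \<Omega> c \<and>
     I = (\<Sum>k\<in>\<Omega> - {-1}. c k / (k + 1))
         + (LINT r:{0<..<1}|lebesgue. f r - singular_part \<Omega> c r)
         + (LINT r:{1<..}|lebesgue. f r))"

end

theory Submission
  imports Defs
begin

text \<open>If \<open>f\<close> is integrable in the generalized sense, then its generalized integral is the Hadamard
  finite part, as \<open>\<epsilon>\<close> tends to \<open>0\<close>, of the tail integrals of \<open>f\<close> over \<open>[\<epsilon>, \<infinity>[\<close>. Finite parts are
  unique: a term \<open>r powr \<nu>\<close> with \<open>\<nu> \<noteq> 0\<close> is eliminated by passing from \<open>F r\<close> to
  \<open>F (l * r) - l powr \<nu> * F r\<close>, which leaves only a logarithm and a constant to compare.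
  Hence the generalized integral is well defined and linear.

  Integration by parts on \<open>[\<epsilon>, \<infinity>[\<close> produces the boundary term \<open>\<epsilon> powr (\<beta> + 1) * exp (-\<epsilon>)\<close>,
  whose finite part is \<open>0\<close> unless \<open>\<beta>\<close> is a negative integer. So the functional equation of
  Gamma extends the Euler integral of \<open>Gamma (\<beta> + 1)\<close> from \<open>Re \<beta> > -1\<close> to all other \<open>\<beta>\<close>.

  Integrating the product of the two polynomials termwise gives \<open>Gamma (\<alpha> + 1)\<close> times a double sum
  of coefficients and Pochhammer symbols. Its inner sum is, for \<open>m \<le> n\<close>, an \<open>n\<close>-th finite difference
  of a polynomial of degree \<open>j \<le> m\<close>, which is nonzero only for \<open>j = m = n\<close>.\<close>

section \<open>Finite parts\<close>

lemma powr_of_real_mult: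
  fixes l r :: real and \<nu> :: complex
  assumes "l > 0" "r > 0"
  shows "complex_of_real (l * r) powr \<nu> = of_real l powr \<nu> * of_real r powr \<nu>"
  using assms by (simp add: powr_times_real)

text \<open>For \<open>l = exp (1 / norm \<nu>)\<close> the power is \<open>exp\<close> of a number
  of modulus 1. Were it 1, that number would be an integer multiple of 2 pi i, hence of modulus 0 or
  more than 6.\<close>

lemma ex_powr_neq_1:
  fixes \<nu> :: complex
  assumes "\<nu> \<noteq> 0"
  obtains l :: real where "l > 0" "complex_of_real l powr \<nu> \<noteq> 1"
proof -
  define l where "l = exp (1 / norm \<nu>)"
  have n: "norm (\<nu> / of_real (norm \<nu>)) = 1"
    using assms by (simp add: norm_divide)
  have "complex_of_real l powr \<nu> = exp (\<nu> / of_real (norm \<nu>))"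
    by (simp add: l_def powr_def flip: exp_of_real)
  moreover have "exp (\<nu> / of_real (norm \<nu>)) \<noteq> 1"
  proof
    assume "exp (\<nu> / of_real (norm \<nu>)) = 1"
    then obtain k :: int where re: "Re (\<nu> / of_real (norm \<nu>)) = 0"
      and k: "Im (\<nu> / of_real (norm \<nu>)) = of_int (2 * k) * pi"
      by (auto simp: exp_eq_1)
    have "\<bar>of_int (2 * k) * pi\<bar> = 1"
      using n unfolding cmod_eq_Im[OF re] k .
    then have e: "2 * pi * \<bar>of_int k\<bar> = 1"
      by (simp add: abs_mult mult_ac)
    then have "k \<noteq> 0" by auto
    then have "(1::real) \<le> \<bar>of_int k\<bar>" by linarith
    then have "2 * pi * 1 \<le> 2 * pi * \<bar>of_int k\<bar>"
      by (intro mult_left_mono) auto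
    with e pi_gt3 show False by linarith
  qed
  ultimately show thesis
    using that[of l] by (simp add: l_def)
qed

lemma filterlim_scale_at_right_0:
  fixes l :: real
  assumes "l > 0"
  shows "filterlim (\<lambda>r. l * r) (at_right 0) (at_right 0)"
  using filterlim_times_pos[of "\<lambda>r. r" 0 "at_right 0" l 0] assms by (simp add: filterlim_ident)

text \<open>Exponents with equal real parts cannot be separated by growth, so they are removed one
  at a time by a dilation. The dilation changes the coefficients, which is why \<open>b\<close>,
  \<open>d\<close> and \<open>e\<close> are arbitrary in the induction.\<close>

lemma log_power_sum_limit_zero:
  fixes b :: "complex \<Rightarrow> complex"
  assumes "finite S" "0 \<notin> S"
    and "((\<lambda>r::real. (\<Sum>\<nu>\<in>S. b \<nu> * of_real r powr \<nu>) + d * of_real (ln r) + e) \<longlongrightarrow> 0) (at_right 0)"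
  shows "d = 0 \<and> e = 0"
  using assms
proof (induction S arbitrary: b d e rule: finite_induct)
  case empty
  then have l: "((\<lambda>r::real. d * of_real (ln r) + e) \<longlongrightarrow> 0) (at_right 0)"
    by simp
  \<comment> \<open>Without powers, comparing the values at \<open>2 * r\<close> and
    \<open>r\<close> leaves only \<open>d * of_real (ln 2)\<close>, which forces
    \<open>d = 0\<close>.\<close>
  have "((\<lambda>r::real. (d * of_real (ln (2 * r)) + e) - (d * of_real (ln r) + e)) \<longlongrightarrow> 0 - 0) (at_right 0)"
    by (intro tendsto_diff l filterlim_compose[OF l filterlim_scale_at_right_0]) simp
  moreover have "\<forall>\<^sub>F r in at_right (0::real).
      (d * of_real (ln (2 * r)) + e) - (d * of_real (ln r) + e) = d * of_real (ln 2)"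
    using eventually_at_right_less[of 0] by eventually_elim (simp add: ln_mult algebra_simps)
  ultimately have "((\<lambda>r::real. d * of_real (ln 2)) \<longlongrightarrow> 0) (at_right 0)"
    by (simp add: tendsto_cong)
  then have "d * of_real (ln 2) = 0"
    by (simp add: tendsto_const_iff)
  then have "d = 0" by simp
  with l show ?case by (simp add: tendsto_const_iff)
next
  case (insert \<mu> S)
  define F where "F = (\<lambda>r::real. (\<Sum>\<nu>\<in>insert \<mu> S. b \<nu> * of_real r powr \<nu>) + d * of_real (ln r) + e)"
  have F: "(F \<longlongrightarrow> 0) (at_right 0)"
    using insert.prems by (simp add: F_def)
  obtain l :: real where l: "l > 0" "complex_of_real l powr \<mu> \<noteq> 1"
    using ex_powr_neq_1[of \<mu>] insert.prems by auto
  \<comment> \<open>\<open>F (l * r) - q * F r\<close> has no \<open>\<mu>\<close>-term, and its logarithmic and constant coefficients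
      vanish iff those of \<open>F\<close> do\<close>
  define q where "q = complex_of_real l powr \<mu>"
  have "((\<lambda>r. F (l * r) - q * F r) \<longlongrightarrow> 0 - q * 0) (at_right 0)"
    by (intro tendsto_diff tendsto_mult tendsto_const F filterlim_compose[OF F filterlim_scale_at_right_0] l)
  moreover have "\<forall>\<^sub>F r in at_right (0::real). F (l * r) - q * F r =
     (\<Sum>\<nu>\<in>S. (b \<nu> * (of_real l powr \<nu> - q)) * of_real r powr \<nu>) + d * (1 - q) * of_real (ln r)
       + (d * of_real (ln l) + e * (1 - q))"
    using eventually_at_right_less[of 0]
  proof eventually_elim
    case (elim r)
    have "(\<Sum>\<nu>\<in>S. (b \<nu> * (of_real l powr \<nu> - q)) * of_real r powr \<nu>) =
      (\<Sum>\<nu>\<in>S. b \<nu> * of_real (l * r) powr \<nu>) - q * (\<Sum>\<nu>\<in>S. b \<nu> * of_real r powr \<nu>)"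
      unfolding sum_distrib_left sum_subtractf[symmetric] powr_of_real_mult[OF l(1) elim]
      by (intro sum.cong refl) (simp add: algebra_simps)
    then show ?case
      using l elim insert.hyps
      by (simp add: F_def ln_mult powr_of_real_mult q_def algebra_simps del: of_real_mult)
  qed
  ultimately have "((\<lambda>r::real. (\<Sum>\<nu>\<in>S. (b \<nu> * (of_real l powr \<nu> - q)) * of_real r powr \<nu>)
      + d * (1 - q) * of_real (ln r) + (d * of_real (ln l) + e * (1 - q))) \<longlongrightarrow> 0) (at_right 0)"
    by (simp add: tendsto_cong)
  from insert.IH[OF _ this] insert.prems
  have "d * (1 - q) = 0" "d * of_real (ln l) + e * (1 - q) = 0" by auto
  with l show ?case by (simp add: q_def)
qed

text \<open>The exponent 0 is excluded because a constant term would make finite parts ambiguous.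
  The logarithm is there as the primitive of the power with exponent -1.\<close>

definition log_power_sums :: "(real \<Rightarrow> complex) set" where
  "log_power_sums = {f. \<exists>S b d. finite S \<and> 0 \<notin> S \<and>
     f = (\<lambda>r. (\<Sum>\<nu>\<in>S. b \<nu> * of_real r powr \<nu>) + d * of_real (ln r))}"

lemma log_power_sumsI:
  assumes "finite S" "0 \<notin> S" "\<And>r. f r = (\<Sum>\<nu>\<in>S. b \<nu> * of_real r powr \<nu>) + d * of_real (ln r)"
  shows "f \<in> log_power_sums"
proof -
  have "f = (\<lambda>r. (\<Sum>\<nu>\<in>S. b \<nu> * of_real r powr \<nu>) + d * of_real (ln r))"
    using assms(3) by (rule ext)
  with assms(1,2) show ?thesis unfolding log_power_sums_def by blast
qed

lemma log_power_sumsE: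
  assumes "f \<in> log_power_sums"
  obtains S b d where "finite S" "0 \<notin> S"
    "\<And>r. f r = (\<Sum>\<nu>\<in>S. b \<nu> * of_real r powr \<nu>) + d * of_real (ln r)"
  using assms unfolding log_power_sums_def by blast

lemma log_power_sums_powr: "\<nu> \<noteq> 0 \<Longrightarrow> (\<lambda>r. of_real r powr \<nu>) \<in> log_power_sums"
  by (rule log_power_sumsI[of "{\<nu>}" _ "\<lambda>_. 1" 0]) simp_all

lemma log_power_sums_ln: "(\<lambda>r. of_real (ln r)) \<in> log_power_sums"
  by (rule log_power_sumsI[of "{}" _ "\<lambda>_. 1" 1]) simp_all

lemma log_power_sums_0: "(\<lambda>r. 0) \<in> log_power_sums"
  by (rule log_power_sumsI[of "{}" _ "\<lambda>_. 1" 0]) simp_all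

lemma log_power_sums_cmult:
  assumes "f \<in> log_power_sums"
  shows "(\<lambda>r. a * f r) \<in> log_power_sums"
proof -
  obtain S b d where S: "finite S" "0 \<notin> S"
    "\<And>r. f r = (\<Sum>\<nu>\<in>S. b \<nu> * of_real r powr \<nu>) + d * of_real (ln r)"
    using assms by (rule log_power_sumsE) blast
  show ?thesis
    by (rule log_power_sumsI[OF S(1,2), of _ "\<lambda>\<nu>. a * b \<nu>" "a * d"])
      (simp add: S(3) sum_distrib_left ring_distribs(1) mult.assoc)
qed

text \<open>Brings two sums with different exponent sets to a common one, so that they can be
  added.\<close>

lemma sum_extend_by_zero:
  assumes "finite T" "S \<subseteq> T"
  shows "(\<Sum>k\<in>T. (if k \<in> S then b k else 0) * g k) = (\<Sum>k\<in>S. b k * (g k :: complex))"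
  using assms by (intro sum.mono_neutral_cong_right) auto

lemma log_power_sums_add:
  assumes "f \<in> log_power_sums" "g \<in> log_power_sums"
  shows "(\<lambda>r. f r + g r) \<in> log_power_sums"
proof -
  obtain S b d where S: "finite S" "0 \<notin> S"
    and f: "\<And>r. f r = (\<Sum>\<nu>\<in>S. b \<nu> * of_real r powr \<nu>) + d * of_real (ln r)"
    using assms(1) by (rule log_power_sumsE) blast
  obtain T b' d' where T: "finite T" "0 \<notin> T"
    and g: "\<And>r. g r = (\<Sum>\<nu>\<in>T. b' \<nu> * of_real r powr \<nu>) + d' * of_real (ln r)"
    using assms(2) by (rule log_power_sumsE) blast
  let ?b = "\<lambda>\<nu>. (if \<nu> \<in> S then b \<nu> else 0) + (if \<nu> \<in> T then b' \<nu> else 0)"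
  have "f r + g r = (\<Sum>\<nu>\<in>S \<union> T. ?b \<nu> * of_real r powr \<nu>) + (d + d') * of_real (ln r)" for r
    unfolding f g ring_distribs(2) sum.distrib using S T by (simp only: sum_extend_by_zero finite_Un Un_upper1 Un_upper2) simp
  with S T show ?thesis
    by (intro log_power_sumsI[of "S \<union> T"]) auto
qed

lemma log_power_sums_sum:
  "(\<And>i. i \<in> A \<Longrightarrow> f i \<in> log_power_sums) \<Longrightarrow> (\<lambda>r. \<Sum>i\<in>A. f i r) \<in> log_power_sums"
  by (induction A rule: infinite_finite_induct) (auto intro: log_power_sums_0 log_power_sums_add)

text \<open>Hadamard's finite part of \<open>F\<close> at \<open>0\<close>: the limit that remains after subtracting non-constant
  powers and a logarithm.\<close>

definition has_finite_part :: "(real \<Rightarrow> complex) \<Rightarrow> complex \<Rightarrow> bool" where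
  "has_finite_part F I \<longleftrightarrow> (\<exists>s\<in>log_power_sums. ((\<lambda>r. F r - s r) \<longlongrightarrow> I) (at_right 0))"

lemma has_finite_partI:
  "s \<in> log_power_sums \<Longrightarrow> ((\<lambda>r. F r - s r) \<longlongrightarrow> I) (at_right 0) \<Longrightarrow> has_finite_part F I"
  unfolding has_finite_part_def by (rule bexI)

text \<open>Subtracting the two limits leaves an element of \<open>log_power_sums\<close> plus the
  constant \<open>J - I\<close>, tending to 0. Then \<open>log_power_sum_limit_zero\<close> applies
  with \<open>e = J - I\<close>.\<close>

lemma has_finite_part_unique:
  assumes "has_finite_part F I" "has_finite_part F J"
  shows "I = J"
proof -
  obtain s t where s: "s \<in> log_power_sums" "((\<lambda>r. F r - s r) \<longlongrightarrow> I) (at_right 0)"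
    and t: "t \<in> log_power_sums" "((\<lambda>r. F r - t r) \<longlongrightarrow> J) (at_right 0)"
    using assms by (auto simp: has_finite_part_def)
  have u: "(\<lambda>r. t r + - 1 * s r) \<in> log_power_sums"
    by (intro log_power_sums_add log_power_sums_cmult s t)
  have "((\<lambda>r. (F r - s r) - (F r - t r) - (I - J)) \<longlongrightarrow> (I - J) - (I - J)) (at_right 0)"
    by (intro tendsto_diff tendsto_const s t)
  moreover have "(F r - s r) - (F r - t r) - (I - J) = (t r + - 1 * s r) + (J - I)" for r
    by simp
  ultimately have l: "((\<lambda>r. (t r + - 1 * s r) + (J - I)) \<longlongrightarrow> 0) (at_right 0)"
    by (simp only: diff_self)
  obtain S b d where S: "finite S" "0 \<notin> S"
    and e: "\<And>r. t r + - 1 * s r = (\<Sum>\<nu>\<in>S. b \<nu> * of_real r powr \<nu>) + d * of_real (ln r)"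
    using u by (rule log_power_sumsE) blast
  show ?thesis
    using log_power_sum_limit_zero[OF S l[unfolded e]] by simp
qed

lemma has_finite_part_tendsto: "(F \<longlongrightarrow> I) (at_right 0) \<Longrightarrow> has_finite_part F I"
  unfolding has_finite_part_def by (rule bexI[OF _ log_power_sums_0]) simp

lemma has_finite_part_log_power_sum: "s \<in> log_power_sums \<Longrightarrow> has_finite_part s 0"
  unfolding has_finite_part_def by (erule bexI[rotated]) simp

lemma has_finite_part_add:
  assumes "has_finite_part F I" "has_finite_part G J"
  shows "has_finite_part (\<lambda>r. F r + G r) (I + J)"
proof -
  obtain s t where s: "s \<in> log_power_sums" "((\<lambda>r. F r - s r) \<longlongrightarrow> I) (at_right 0)"
    and t: "t \<in> log_power_sums" "((\<lambda>r. G r - t r) \<longlongrightarrow> J) (at_right 0)"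
    using assms by (auto simp: has_finite_part_def)
  have "((\<lambda>r. (F r + G r) - (s r + t r)) \<longlongrightarrow> I + J) (at_right 0)"
    using tendsto_add[OF s(2) t(2)] by (simp add: add_diff_add)
  with log_power_sums_add[OF s(1) t(1)] show ?thesis
    by (rule has_finite_partI)
qed

lemma has_finite_part_cmult:
  assumes "has_finite_part F I"
  shows "has_finite_part (\<lambda>r. a * F r) (a * I)"
proof -
  obtain s where s: "s \<in> log_power_sums" "((\<lambda>r. F r - s r) \<longlongrightarrow> I) (at_right 0)"
    using assms by (auto simp: has_finite_part_def)
  have "((\<lambda>r. a * F r - a * s r) \<longlongrightarrow> a * I) (at_right 0)"
    using tendsto_mult[OF tendsto_const s(2), of a] by (simp add: right_diff_distrib)
  with log_power_sums_cmult[OF s(1), of a] show ?thesis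
    by (rule has_finite_partI)
qed

text \<open>The limit at 0 only sees small \<open>r\<close>. The bound \<open>r < 1\<close> fits the
  formulas for tail integrals, which are available for \<open>\<epsilon> < 1\<close>.\<close>

lemma has_finite_part_cong:
  assumes "\<And>r. r > 0 \<Longrightarrow> r < 1 \<Longrightarrow> F r = G r" "has_finite_part F I"
  shows "has_finite_part G I"
proof -
  have "\<forall>\<^sub>F r in at_right (0::real). 0 < r \<and> r < 1"
    by (auto simp: eventually_at_right_field intro: exI[of _ 1])
  then have ev: "\<forall>\<^sub>F r in at_right 0. F r - s r = G r - s r" for s :: "real \<Rightarrow> complex"
    by eventually_elim (auto simp: assms(1))
  with assms(2) show ?thesis
    unfolding has_finite_part_def by (simp add: tendsto_cong[OF ev])
qed

section \<open>The generalized integral as a finite part\<close>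

text \<open>Normalized without a constant of integration, so that it belongs to
  \<open>log_power_sums\<close> for each \<open>k\<close>. Its value at 1 is
  \<open>1 / (k + 1)\<close>, or 0 for \<open>k = -1\<close>.\<close>

definition powr_primitive :: "complex \<Rightarrow> real \<Rightarrow> complex" where
  "powr_primitive k r = (if k = -1 then of_real (ln r) else of_real r powr (k + 1) / (k + 1))"

lemma has_integral_powr_real:
  fixes \<epsilon> :: real
  assumes "0 < \<epsilon>" "\<epsilon> \<le> 1"
  shows "((\<lambda>r. complex_of_real r powr k) has_integral (powr_primitive k 1 - powr_primitive k \<epsilon>)) {\<epsilon>..1}"
proof (rule fundamental_theorem_of_calculus)
  fix r assume "r \<in> {\<epsilon>..1}"
  then have r: "r > 0" using assms by auto
  show "(powr_primitive k has_vector_derivative complex_of_real r powr k) (at r within {\<epsilon>..1})"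
  proof (cases "k = -1")
    case True
    have "((\<lambda>r. complex_of_real (ln r)) has_vector_derivative complex_of_real (1 / r)) (at r within {\<epsilon>..1})"
      using r by (intro has_vector_derivative_of_real)
        (auto intro!: derivative_eq_intros simp: has_real_derivative_iff_has_vector_derivative[symmetric])
    with True r show ?thesis
      by (simp add: powr_primitive_def [abs_def] powr_minus field_simps)
  next
    case False
    then have k: "k + 1 \<noteq> 0"
      by (metis add.commute add_eq_0_iff)
    have "((\<lambda>z. z powr (k + 1)) has_field_derivative (k + 1) * complex_of_real r powr (k + 1 - 1)) (at (of_real r))"
      by (rule has_field_derivative_powr) (use r in auto)
    then have "((\<lambda>z. z powr (k + 1) / (k + 1)) has_field_derivative (k + 1) * complex_of_real r powr (k + 1 - 1) / (k + 1)) (at (of_real r))"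
      by (rule DERIV_cdivide)
    then have "((\<lambda>z. z powr (k + 1) / (k + 1)) has_field_derivative complex_of_real r powr k) (at (of_real r))"
      using k by simp
    from has_vector_derivative_real_field[OF this] False show ?thesis
      by (simp add: powr_primitive_def [abs_def])
  qed
qed (use assms in simp)

lemma powr_primitive_log_power_sums: "powr_primitive k \<in> log_power_sums"
proof (cases "k = -1")
  case True
  then show ?thesis using log_power_sums_ln by (simp add: powr_primitive_def [abs_def])
next
  case False
  then have k: "k + 1 \<noteq> 0"
    by (metis add.commute add_eq_0_iff)
  from log_power_sums_cmult[OF log_power_sums_powr[OF k], of "1 / (k + 1)"] False
  show ?thesis by (simp add: powr_primitive_def [abs_def])
qed

lemma singular_part_has_integral:
  fixes \<epsilon> :: real
  assumes "finite \<Omega>" "0 < \<epsilon>" "\<epsilon> \<le> 1"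
  shows "(singular_part \<Omega> c has_integral
     ((\<Sum>k\<in>\<Omega> - {-1}. c k / (k + 1)) - (\<Sum>k\<in>\<Omega>. c k * powr_primitive k \<epsilon>))) {\<epsilon>..1}"
proof -
  have "(singular_part \<Omega> c has_integral
      (\<Sum>k\<in>\<Omega>. c k * (powr_primitive k 1 - powr_primitive k \<epsilon>))) {\<epsilon>..1}"
    unfolding singular_part_def [abs_def] using assms
    by (intro has_integral_sum has_integral_mult_right has_integral_powr_real)
  \<comment> \<open>The exponent -1 drops out because its primitive \<open>ln\<close> vanishes at 1;
    this matches the index set \<open>\<Omega> - {-1}\<close> in the definition of the generalized
    integral.\<close>
  moreover have "(\<Sum>k\<in>\<Omega>. c k * powr_primitive k 1) = (\<Sum>k\<in>\<Omega> - {-1}. c k / (k + 1))"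
    using assms(1) by (intro sum.mono_neutral_cong_right) (auto simp: powr_primitive_def)
  ultimately show ?thesis
    by (simp add: right_diff_distrib sum_subtractf)
qed

lemma continuous_on_singular_part:
  "A \<subseteq> {0<..} \<Longrightarrow> continuous_on A (singular_part \<Omega> c)"
  unfolding singular_part_def [abs_def]
  by (intro continuous_intros) auto

text \<open>The passage from open to closed intervals affects only the endpoints
  \<open>\<epsilon>\<close> and 1, a negligible set.\<close>

lemma tail_decomposition:
  fixes f :: "real \<Rightarrow> complex"
  assumes f: "f absolutely_integrable_on {1<..}" and \<epsilon>: "0 < \<epsilon>" "\<epsilon> < 1"
    and g: "f absolutely_integrable_on {\<epsilon><..<1}"
  shows "f absolutely_integrable_on {\<epsilon>..}"
    and "integral {\<epsilon>..} f = integral {\<epsilon>..1} f + integral {1<..} f"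
proof -
  have e: "{\<epsilon>..1} \<union> {1<..} = {\<epsilon>..}" using \<epsilon> by auto
  have d: "{\<epsilon>..1} \<inter> {1<..} = {}" by auto
  have n: "negligible {\<epsilon>, 1}" by simp
  have g': "f absolutely_integrable_on {\<epsilon>..1}"
    using g
    by (subst absolutely_integrable_spike_set_eq[of _ "{\<epsilon><..<1}"])
      (auto intro!: negligible_subset[OF n])
  show "f absolutely_integrable_on {\<epsilon>..}"
    using absolutely_integrable_Un[OF g' f] unfolding e .
  have "integral ({\<epsilon>..1} \<union> {1<..}) f = integral {\<epsilon>..1} f + integral {1<..} f"
    by (rule integral_Un) (use g' f in \<open>auto simp: absolutely_integrable_on_def d\<close>)
  then show "integral {\<epsilon>..} f = integral {\<epsilon>..1} f + integral {1<..} f"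
    unfolding e .
qed

text \<open>Splitting the tail at 1 and subtracting the singular part on the bounded piece leaves a
  convergent integral, the constants of the definition, and primitives evaluated at
  \<open>\<epsilon>\<close>. The latter form an element of \<open>log_power_sums\<close> and have
  finite part 0.\<close>

lemma
  assumes f: "f absolutely_integrable_on {1<..}" and ge: "gen_expansion f \<Omega> c"
  shows gen_expansion_tail_integrable: "\<And>\<epsilon>. 0 < \<epsilon> \<Longrightarrow> \<epsilon> < 1 \<Longrightarrow> f absolutely_integrable_on {\<epsilon>..}"
    and gen_expansion_has_finite_part:
      "has_finite_part (\<lambda>\<epsilon>. integral {\<epsilon>..} f)
         ((\<Sum>k\<in>\<Omega> - {-1}. c k / (k + 1))
         + (LINT r:{0<..<1}|lebesgue. f r - singular_part \<Omega> c r)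
         + (LINT r:{1<..}|lebesgue. f r))"
proof -
  define g where "g = (\<lambda>r. f r - singular_part \<Omega> c r)"
  have fin: "finite \<Omega>" and g: "g absolutely_integrable_on {0<..<1}"
    using ge by (auto simp: gen_expansion_def g_def)
  have s_int: "singular_part \<Omega> c absolutely_integrable_on {\<epsilon>..1}" if "\<epsilon> > 0" for \<epsilon>
    by (intro absolutely_integrable_continuous_real continuous_on_singular_part) (use that in auto)
  have g_int: "g absolutely_integrable_on {\<epsilon><..<1}" if "\<epsilon> > 0" for \<epsilon>
    by (rule set_integrable_subset[OF g]) (use that in auto)
  have f_int: "f absolutely_integrable_on {\<epsilon><..<1}" if "\<epsilon> > 0" for \<epsilon>
  proof -
    have "singular_part \<Omega> c absolutely_integrable_on {\<epsilon><..<1}"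
      by (rule set_integrable_subset[OF s_int[OF that]]) auto
    from set_integral_add(1)[OF g_int[OF that] this] show ?thesis
      by (simp add: g_def)
  qed
  show "f absolutely_integrable_on {\<epsilon>..}" if "0 < \<epsilon>" "\<epsilon> < 1" for \<epsilon>
    using tail_decomposition(1)[OF f that f_int] that by simp
  have gI: "g integrable_on {0..1}"
    using g by (simp add: integrable_on_Icc_iff_Ioo absolutely_integrable_on_def)
  have eq: "integral {\<epsilon>..} f = integral {\<epsilon>..1} g + (((\<Sum>k\<in>\<Omega> - {-1}. c k / (k + 1)) + integral {1<..} f)
      + - 1 * (\<Sum>k\<in>\<Omega>. c k * powr_primitive k \<epsilon>))"
    if \<epsilon>: "0 < \<epsilon>" "\<epsilon> < 1" for \<epsilon>
  proof -
    have s: "(singular_part \<Omega> c has_integral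
     ((\<Sum>k\<in>\<Omega> - {-1}. c k / (k + 1)) - (\<Sum>k\<in>\<Omega>. c k * powr_primitive k \<epsilon>))) {\<epsilon>..1}"
      using singular_part_has_integral[OF fin \<epsilon>(1)] \<epsilon> by simp
    have "g integrable_on {\<epsilon>..1}"
      by (rule integrable_on_subinterval[OF gI]) (use \<epsilon> in auto)
    from has_integral_add[OF integrable_integral[OF this] s]
    have "integral {\<epsilon>..1} f = integral {\<epsilon>..1} g +
       ((\<Sum>k\<in>\<Omega> - {-1}. c k / (k + 1)) - (\<Sum>k\<in>\<Omega>. c k * powr_primitive k \<epsilon>))"
      by (intro integral_unique) (simp add: g_def)
    with tail_decomposition(2)[OF f \<epsilon> f_int] \<epsilon> show ?thesis by simp
  qed
  \<comment> \<open>\<open>g\<close> is integrable up to 0, so its integral depends continuously on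
    the lower endpoint down to \<open>\<epsilon> = 0\<close>.\<close>
  have "continuous_on {0..1} (\<lambda>\<epsilon>. integral {\<epsilon>..1} g)"
    by (rule indefinite_integral_continuous_1'[OF gI])
  then have "((\<lambda>\<epsilon>. integral {\<epsilon>..1} g) \<longlongrightarrow> integral {0..1} g) (at 0 within {0..1})"
    unfolding continuous_on_def by (metis atLeastAtMost_iff order_refl zero_le_one)
  then have lim: "((\<lambda>\<epsilon>. integral {\<epsilon>..1} g) \<longlongrightarrow> integral {0..1} g) (at_right 0)"
    by (simp add: at_within_Icc_at_right)
  have L1: "(LINT r:{0<..<1}|lebesgue. f r - singular_part \<Omega> c r) = integral {0..1} g"
    using set_lebesgue_integral_eq_integral(2)[OF g] by (simp add: g_def integral_open_interval_real)
  have L2: "(LINT r:{1<..}|lebesgue. f r) = integral {1<..} f"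
    by (rule set_lebesgue_integral_eq_integral(2)[OF f])
  have sums: "(\<lambda>\<epsilon>. \<Sum>k\<in>\<Omega>. c k * powr_primitive k \<epsilon>) \<in> log_power_sums"
    by (intro log_power_sums_sum log_power_sums_cmult powr_primitive_log_power_sums)
  have "has_finite_part (\<lambda>\<epsilon>. integral {\<epsilon>..1} g + (((\<Sum>k\<in>\<Omega> - {-1}. c k / (k + 1)) + integral {1<..} f)
      + - 1 * (\<Sum>k\<in>\<Omega>. c k * powr_primitive k \<epsilon>)))
    (integral {0..1} g + (((\<Sum>k\<in>\<Omega> - {-1}. c k / (k + 1)) + integral {1<..} f) + - 1 * 0))"
    by (intro has_finite_part_add has_finite_part_cmult has_finite_part_tendsto[OF lim]
        has_finite_part_log_power_sum[OF sums] has_finite_part_tendsto[OF tendsto_const])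
  then have "has_finite_part (\<lambda>\<epsilon>. integral {\<epsilon>..} f)
     (integral {0..1} g + (((\<Sum>k\<in>\<Omega> - {-1}. c k / (k + 1)) + integral {1<..} f) + - 1 * 0))"
    by (rule has_finite_part_cong[rotated]) (simp add: eq)
  then show "has_finite_part (\<lambda>\<epsilon>. integral {\<epsilon>..} f)
         ((\<Sum>k\<in>\<Omega> - {-1}. c k / (k + 1))
         + (LINT r:{0<..<1}|lebesgue. f r - singular_part \<Omega> c r)
         + (LINT r:{1<..}|lebesgue. f r))"
    unfolding L1 L2 by (simp add: add_ac)
qed

text \<open>Every expansion of \<open>f\<close> yields a finite part of the same function, the tail
  integral, so all candidates in the definite description equal \<open>I\<close>.\<close>

lemma gen_integral_eqI:
  assumes "gen_integrable f" "has_finite_part (\<lambda>\<epsilon>. integral {\<epsilon>..} f) I"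
  shows "gen_integral f = I"
proof -
  have f: "f absolutely_integrable_on {1<..}"
    using assms(1) by (simp add: gen_integrable_def)
  have uniq: "(\<Sum>k\<in>\<Omega> - {-1}. c k / (k + 1))
         + (LINT r:{0<..<1}|lebesgue. f r - singular_part \<Omega> c r)
         + (LINT r:{1<..}|lebesgue. f r) = I" if "gen_expansion f \<Omega> c" for \<Omega> c
    by (rule has_finite_part_unique[OF gen_expansion_has_finite_part[OF f that] assms(2)])
  obtain \<Omega> c where "gen_expansion f \<Omega> c"
    using assms(1) by (auto simp: gen_integrable_def)
  then show ?thesis
    unfolding gen_integral_def
    by (intro the_equality) (use uniq in \<open>blast+\<close>)
qed

section \<open>Linearity of the generalized integral\<close>

lemma gen_integrable_tail:
  "gen_integrable f \<Longrightarrow> 0 < \<epsilon> \<Longrightarrow> \<epsilon> < 1 \<Longrightarrow> f absolutely_integrable_on {\<epsilon>..}"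
  unfolding gen_integrable_def using gen_expansion_tail_integrable by blast

lemma gen_integrable_cmult:
  assumes "gen_integrable f"
  shows "gen_integrable (\<lambda>r. a * f r)"
proof -
  obtain \<Omega> c where ge: "gen_expansion f \<Omega> c"
    using assms by (auto simp: gen_integrable_def)
  have "a * f r - singular_part \<Omega> (\<lambda>k. a * c k) r = a * (f r - singular_part \<Omega> c r)" for r
    by (simp add: singular_part_def right_diff_distrib sum_distrib_left mult.assoc)
  with ge have "gen_expansion (\<lambda>r. a * f r) \<Omega> (\<lambda>k. a * c k)"
    by (simp add: gen_expansion_def)
  with assms show ?thesis
    unfolding gen_integrable_def by (blast intro: set_integrable_mult_right)
qed

lemma gen_integrable_add:
  assumes "gen_integrable f" "gen_integrable g"
  shows "gen_integrable (\<lambda>r. f r + g r)"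
proof -
  obtain \<Omega> c where f: "gen_expansion f \<Omega> c"
    using assms by (auto simp: gen_integrable_def)
  obtain \<Omega>' c' where g: "gen_expansion g \<Omega>' c'"
    using assms by (auto simp: gen_integrable_def)
  \<comment> \<open>Coefficients of common exponents add up; the others are extended by
    zero.\<close>
  let ?c = "\<lambda>k. (if k \<in> \<Omega> then c k else 0) + (if k \<in> \<Omega>' then c' k else 0)"
  have fin: "finite (\<Omega> \<union> \<Omega>')" using f g by (simp add: gen_expansion_def)
  have "singular_part (\<Omega> \<union> \<Omega>') ?c r = singular_part \<Omega> c r + singular_part \<Omega>' c' r" for r
    unfolding singular_part_def ring_distribs(2) sum.distrib
    using fin by (simp only: sum_extend_by_zero Un_upper1 Un_upper2)
  then have e: "f r + g r - singular_part (\<Omega> \<union> \<Omega>') ?c r =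
      (f r - singular_part \<Omega> c r) + (g r - singular_part \<Omega>' c' r)" for r
    by simp
  have "gen_expansion (\<lambda>r. f r + g r) (\<Omega> \<union> \<Omega>') ?c"
    using f g fin unfolding gen_expansion_def e by (intro conjI set_integral_add(1)) auto
  with assms show ?thesis
    unfolding gen_integrable_def by (blast intro: set_integral_add(1))
qed

lemma gen_integrable_zero: "gen_integrable (\<lambda>r. 0)"
  unfolding gen_integrable_def gen_expansion_def
  by (auto intro!: exI[of _ "{}"] simp: singular_part_def set_integrable_def)

text \<open>A relational form: linearity is proved for it without handling the definite description,
  which is evaluated only at the end.\<close>

definition has_gen_integral :: "(real \<Rightarrow> complex) \<Rightarrow> complex \<Rightarrow> bool" where
  "has_gen_integral f I \<longleftrightarrow> gen_integrable f \<and> has_finite_part (\<lambda>\<epsilon>. integral {\<epsilon>..} f) I"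

lemma has_gen_integral_cmult:
  "has_gen_integral f I \<Longrightarrow> has_gen_integral (\<lambda>r. a * f r) (a * I)"
  by (simp add: has_gen_integral_def gen_integrable_cmult has_finite_part_cmult)

lemma has_gen_integral_add:
  assumes "has_gen_integral f I" "has_gen_integral g J"
  shows "has_gen_integral (\<lambda>r. f r + g r) (I + J)"
proof -
  have "integral {\<epsilon>..} f + integral {\<epsilon>..} g = integral {\<epsilon>..} (\<lambda>r. f r + g r)" if "0 < \<epsilon>" "\<epsilon> < 1" for \<epsilon>
    using assms gen_integrable_tail[OF _ that]
    by (intro integral_add[symmetric]) (auto simp: has_gen_integral_def absolutely_integrable_on_def)
  from has_finite_part_cong[OF this has_finite_part_add] assms show ?thesis
    by (simp add: has_gen_integral_def gen_integrable_add)
qed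

lemma has_gen_integral_zero: "has_gen_integral (\<lambda>r. 0) 0"
  by (simp add: has_gen_integral_def gen_integrable_zero has_finite_part_tendsto)

lemma has_gen_integral_sum:
  "(\<And>i. i \<in> A \<Longrightarrow> has_gen_integral (f i) (I i)) \<Longrightarrow>
   has_gen_integral (\<lambda>r. \<Sum>i\<in>A. f i r) (\<Sum>i\<in>A. I i)"
  by (induction A rule: infinite_finite_induct) (auto intro: has_gen_integral_zero has_gen_integral_add)

lemma has_gen_integral_imp_gen_integral: "has_gen_integral f I \<Longrightarrow> gen_integral f = I"
  by (simp add: has_gen_integral_def gen_integral_eqI)

section \<open>Sums of Laguerre coefficients\<close>

text \<open>Pascal's rule writes the sum for \<open>Suc n\<close> as the difference of the sums for
  \<open>n\<close> at \<open>x\<close> and \<open>x + 1\<close>, hence the arbitrary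
  \<open>x\<close>. Differencing a Pochhammer symbol lowers its degree by one and produces a factor
  \<open>- of_nat j\<close>; for \<open>j = n\<close> these factors build up
  \<open>(-1) ^ n * fact n\<close>.\<close>

lemma sum_alternating_binomial_pochhammer:
  fixes x :: complex
  assumes "j \<le> n"
  shows "(\<Sum>k=0..n. (-1) ^ k * of_nat (n choose k) * pochhammer (x + of_nat k) j) =
    (if j = n then (-1) ^ n * fact n else 0)"
  using assms
proof (induction n arbitrary: x j)
  case (Suc n)
  let ?S = "\<lambda>n x j. \<Sum>k=0..n. (-1) ^ k * of_nat (n choose k) * pochhammer ((x::complex) + of_nat k) j"
  have "?S (Suc n) x j = pochhammer x j + (\<Sum>k=0..n. (-1) ^ Suc k * of_nat (Suc n choose Suc k) *
      pochhammer (x + of_nat (Suc k)) j)"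
    by (subst sum.atLeast0_atMost_Suc_shift) simp
  also have "\<dots> = pochhammer x j + (\<Sum>k=0..n. (-1) ^ Suc k * of_nat (n choose Suc k) *
      pochhammer (x + of_nat (Suc k)) j) - ?S n (x + 1) j"
    by (simp add: algebra_simps sum.distrib sum_subtractf sum_negf)
  also have "pochhammer x j + (\<Sum>k=0..n. (-1) ^ Suc k * of_nat (n choose Suc k) *
      pochhammer (x + of_nat (Suc k)) j) =
      (\<Sum>k=0..Suc n. (-1) ^ k * of_nat (n choose k) * pochhammer (x + of_nat k) j)"
    unfolding sum.atLeast0_atMost_Suc_shift by simp
  \<comment> \<open>The term \<open>k = Suc n\<close> is zero, since
    \<open>n choose Suc n = 0\<close>.\<close>
  also have "\<dots> = ?S n x j" by simp
  finally have rec: "?S (Suc n) x j = ?S n x j - ?S n (x + 1) j" .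
  show ?case
  proof (cases j)
    case 0
    \<comment> \<open>Since \<open>pochhammer y 0 = 1\<close>, the two sums do not depend on
      \<open>x\<close> and cancel.\<close>
    then show ?thesis unfolding rec by simp
  next
    case (Suc i)
    have d: "pochhammer (y::complex) j - pochhammer (y + 1) j = - of_nat j * pochhammer (y + 1) i" for y
    proof -
      have "pochhammer y j = y * pochhammer (y + 1) i"
        by (simp add: Suc pochhammer_rec)
      moreover have "pochhammer (y + 1) j = (y + 1 + of_nat i) * pochhammer (y + 1) i"
        by (simp add: Suc pochhammer_rec')
      ultimately show ?thesis by (simp add: Suc algebra_simps)
    qed
    have "?S n x j - ?S n (x + 1) j = (\<Sum>k=0..n. (-1) ^ k * of_nat (n choose k) *
       (pochhammer (x + of_nat k) j - pochhammer (x + of_nat k + 1) j))"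
      by (simp add: sum_subtractf algebra_simps)
    also have "\<dots> = - of_nat j * ?S n (x + 1) i"
      unfolding d sum_distrib_left by (intro sum.cong) (simp_all add: algebra_simps)
    also have "\<dots> = - of_nat j * (if i = n then (-1) ^ n * fact n else 0)"
      using Suc.prems Suc by (subst Suc.IH) auto
    also have "\<dots> = (if j = Suc n then (-1) ^ Suc n * fact (Suc n) else 0)"
      using Suc by (simp add: algebra_simps)
    finally show ?thesis unfolding rec .
  qed
qed simp

text \<open>The familiar coefficient, \<open>(-1) ^ k / fact k\<close> times the binomial
  coefficient of \<open>\<alpha> + n\<close> over \<open>n - k\<close>, written with a Pochhammer
  symbol that starts where \<open>pochhammer (\<alpha> + 1) k\<close> ends.\<close>

definition Laguerre_coeff :: "complex \<Rightarrow> nat \<Rightarrow> nat \<Rightarrow> complex" where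
  "Laguerre_coeff \<alpha> n k =
     (-1) ^ k * pochhammer (\<alpha> + of_nat k + 1) (n - k) / (fact k * fact (n - k))"

text \<open>Reversing the factors of \<open>pochhammer (- \<alpha> - of_nat n) (n - k)\<close> and
  changing their signs makes it start at \<open>\<alpha> + of_nat k + 1\<close>.\<close>

lemma Laguerre_eq_sum_coeff: "Laguerre \<alpha> n z = (\<Sum>k=0..n. Laguerre_coeff \<alpha> n k * z ^ k)"
  unfolding Laguerre_def sum_distrib_left
proof (intro sum.cong refl)
  fix k assume k: "k \<in> {0..n}"
  have "pochhammer (- \<alpha> - of_nat n) (n - k) = (-1) ^ (n - k) * pochhammer (\<alpha> + of_nat k + 1) (n - k)"
    using pochhammer_minus[of "\<alpha> + of_nat n" "n - k"] k by (simp add: of_nat_diff algebra_simps)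
  moreover have "(-1) ^ n * (-1) ^ (n - k) = ((-1) ^ k :: complex)"
    using k by (simp add: minus_one_power_iff)
  ultimately show "(-1) ^ n * (pochhammer (- \<alpha> - of_nat n) (n - k) * z ^ k / (fact k * fact (n - k))) =
      Laguerre_coeff \<alpha> n k * z ^ k"
    by (simp add: Laguerre_coeff_def mult.assoc [symmetric])
qed

text \<open>For admissible \<open>\<alpha>\<close> and up to the factor
  \<open>Gamma (\<alpha> + 1)\<close>, the left side is the generalized integral of
  \<open>x ^ j\<close> times the Laguerre polynomial against the weight. The factor
  \<open>pochhammer (\<alpha> + 1) k\<close> completes the symbol in the coefficient to
  \<open>pochhammer (\<alpha> + 1) n\<close>, which leaves a finite difference.\<close>

lemma sum_Laguerre_coeff_pochhammer:
  assumes "j \<le> n"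
  shows "(\<Sum>k=0..n. Laguerre_coeff \<alpha> n k * pochhammer (\<alpha> + 1) (j + k)) =
    (if j = n then (-1) ^ n * pochhammer (\<alpha> + 1) n else 0)"
proof -
  have "(\<Sum>k=0..n. Laguerre_coeff \<alpha> n k * pochhammer (\<alpha> + 1) (j + k)) =
    (\<Sum>k=0..n. pochhammer (\<alpha> + 1) n / fact n *
       ((-1) ^ k * of_nat (n choose k) * pochhammer (\<alpha> + 1 + of_nat k) j))"
  proof (intro sum.cong refl)
    fix k assume k: "k \<in> {0..n}"
    have "pochhammer (\<alpha> + 1) n = pochhammer (\<alpha> + 1) k * pochhammer (\<alpha> + of_nat k + 1) (n - k)"
      using pochhammer_product[of k n "\<alpha> + 1"] k by (simp add: add_ac)
    moreover have "pochhammer (\<alpha> + 1) (j + k) = pochhammer (\<alpha> + 1) k * pochhammer (\<alpha> + 1 + of_nat k) j"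
      using pochhammer_product'[of "\<alpha> + 1" k j] by (simp add: add_ac)
    moreover have "of_nat (n choose k) = (fact n / (fact k * fact (n - k)) :: complex)"
      using k by (simp add: binomial_fact)
    ultimately show "Laguerre_coeff \<alpha> n k * pochhammer (\<alpha> + 1) (j + k) =
      pochhammer (\<alpha> + 1) n / fact n *
       ((-1) ^ k * of_nat (n choose k) * pochhammer (\<alpha> + 1 + of_nat k) j)"
      by (simp add: Laguerre_coeff_def)
  qed
  also have "\<dots> = pochhammer (\<alpha> + 1) n / fact n *
      (if j = n then (-1) ^ n * fact n else 0)"
    unfolding sum_distrib_left[symmetric] by (simp only: sum_alternating_binomial_pochhammer[OF assms])
  finally show ?thesis by auto
qed

text \<open>As \<open>j \<le> m \<le> n\<close>, the inner sum survives only at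
  \<open>j = n\<close>, which forces \<open>m = n\<close>. The remaining factor is the leading
  coefficient \<open>(-1) ^ n / fact n\<close>, and the signs cancel.\<close>

lemma sum_Laguerre_coeff_le:
  assumes "m \<le> n"
  shows "(\<Sum>j=0..m. \<Sum>k=0..n. Laguerre_coeff \<alpha> m j * Laguerre_coeff \<alpha> n k * pochhammer (\<alpha> + 1) (j + k)) =
    (if m = n then pochhammer (\<alpha> + 1) n / fact n else 0)"
proof -
  have "(\<Sum>j=0..m. \<Sum>k=0..n. Laguerre_coeff \<alpha> m j * Laguerre_coeff \<alpha> n k * pochhammer (\<alpha> + 1) (j + k)) =
    (\<Sum>j=0..m. Laguerre_coeff \<alpha> m j * (if j = n then (-1) ^ n * pochhammer (\<alpha> + 1) n else 0))"
    using assms by (intro sum.cong refl)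
      (simp add: sum_Laguerre_coeff_pochhammer[symmetric] sum_distrib_left mult.assoc)
  also have "\<dots> = (if m = n then Laguerre_coeff \<alpha> n n * ((-1) ^ n * pochhammer (\<alpha> + 1) n) else 0)"
    using assms by (auto simp: if_distrib [of "\<lambda>x. _ * x"] cong: if_cong)
  finally show ?thesis by (simp add: Laguerre_coeff_def flip: power_mult_distrib)
qed

lemma sum_Laguerre_coeff:
  "(\<Sum>j=0..m. \<Sum>k=0..n. Laguerre_coeff \<alpha> m j * Laguerre_coeff \<alpha> n k * pochhammer (\<alpha> + 1) (j + k)) =
    (if m = n then pochhammer (\<alpha> + 1) n / fact n else 0)"
proof (cases "m \<le> n")
  case False
  have "(\<Sum>j=0..m. \<Sum>k=0..n. Laguerre_coeff \<alpha> m j * Laguerre_coeff \<alpha> n k * pochhammer (\<alpha> + 1) (j + k)) =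
    (\<Sum>k=0..n. \<Sum>j=0..m. Laguerre_coeff \<alpha> n k * Laguerre_coeff \<alpha> m j * pochhammer (\<alpha> + 1) (k + j))"
    by (subst sum.swap) (simp add: mult_ac add_ac)
  with False show ?thesis by (simp add: sum_Laguerre_coeff_le)
qed (rule sum_Laguerre_coeff_le)

section \<open>The generalized Gamma integral\<close>

definition gamma_integrand :: "complex \<Rightarrow> real \<Rightarrow> complex" where
  "gamma_integrand \<beta> r = of_real r powr \<beta> * exp (- of_real r)"

text \<open>The exponent \<open>\<beta> + 1 - 1\<close> and the quotient by \<open>exp\<close> have
  the shape of the library's Euler integral for \<open>Gamma (\<beta> + 1)\<close>.\<close>

lemma gamma_integrand_eq_divide:
  "gamma_integrand \<beta> r = of_real r powr (\<beta> + 1 - 1) / of_real (exp r)"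
  by (simp add: gamma_integrand_def exp_minus exp_of_real[symmetric] field_simps)

lemma continuous_on_gamma_integrand: "A \<subseteq> {0<..} \<Longrightarrow> continuous_on A (gamma_integrand \<beta>)"
  unfolding gamma_integrand_def [abs_def] by (intro continuous_intros) auto

lemma add_of_nat_nonzero_imp_notin_nonpos_Ints:
  fixes z :: complex
  assumes "\<And>j::nat. z + of_nat j \<noteq> 0"
  shows "z \<notin> \<int>\<^sub>\<le>\<^sub>0"
proof
  assume "z \<in> \<int>\<^sub>\<le>\<^sub>0"
  then obtain j where "z = - of_nat j" by (elim nonpos_Ints_cases')
  with assms[of j] show False by simp
qed

section \<open>Behaviour of the Euler integrand at 0 and at infinity\<close>

lemma norm_gamma_integrand: "r > 0 \<Longrightarrow> norm (gamma_integrand \<beta> r) = r powr Re \<beta> * exp (- r)"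
  by (simp add: gamma_integrand_def norm_mult norm_powr_real_powr flip: exp_of_real of_real_minus)

text \<open>At \<open>r = 0\<close> both sides are 0 because \<open>0 powr _ = 0\<close>. Thus the
  product of polynomials can be expanded as an identity of functions on all reals.\<close>

lemma gamma_integrand_add_nat:
  "gamma_integrand (\<beta> + of_nat k) r = of_real r ^ k * gamma_integrand \<beta> r"
  by (cases "r = 0") (simp_all add: gamma_integrand_def powr_add)

text \<open>Raising the exponent by \<open>N\<close> brings its real part above -1, where Euler's
  integral converges absolutely. On the tail \<open>r ^ N\<close> is at least
  \<open>\<epsilon> ^ N\<close>, so the original integrand is dominated.\<close>

lemma gamma_integrand_tail_integrable:
  assumes \<epsilon>: "\<epsilon> > 0"
  shows "gamma_integrand \<beta> absolutely_integrable_on {\<epsilon>..}"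
proof -
  define N where "N = nat \<lceil>\<bar>Re \<beta>\<bar>\<rceil>"
  have N: "Re (\<beta> + of_nat N + 1) > 0"
    unfolding N_def by simp linarith
  have "gamma_integrand (\<beta> + of_nat N) absolutely_integrable_on {0<..}"
    using absolutely_integrable_Gamma_integral'[OF N]
    unfolding gamma_integrand_eq_divide [abs_def] .
  then have "gamma_integrand (\<beta> + of_nat N) absolutely_integrable_on {\<epsilon>..}"
    by (rule set_integrable_subset) (use \<epsilon> in auto)
  then have g: "(\<lambda>r. (1 / \<epsilon> ^ N) * norm (gamma_integrand (\<beta> + of_nat N) r)) integrable_on {\<epsilon>..}"
    by (intro integrable_on_mult_right) (simp add: absolutely_integrable_on_def)
  show ?thesis
  proof (rule measurable_bounded_by_integrable_imp_absolutely_integrable[OF _ _ g])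
    show "gamma_integrand \<beta> \<in> borel_measurable (lebesgue_on {\<epsilon>..})"
      by (intro continuous_imp_measurable_on_sets_lebesgue continuous_on_gamma_integrand) (use \<epsilon> in auto)
    fix r assume "r \<in> {\<epsilon>..}"
    then have r: "r \<ge> \<epsilon>" "r > 0" using \<epsilon> by auto
    have "1 \<le> r ^ N / \<epsilon> ^ N"
      using r \<epsilon> by (simp add: power_mono)
    then have "1 * norm (gamma_integrand \<beta> r) \<le> r ^ N / \<epsilon> ^ N * norm (gamma_integrand \<beta> r)"
      by (rule mult_right_mono) simp
    also have "\<dots> = (1 / \<epsilon> ^ N) * norm (gamma_integrand (\<beta> + of_nat N) r)"
      using r by (simp add: gamma_integrand_add_nat norm_mult norm_power)
    finally show "norm (gamma_integrand \<beta> r) \<le> (1 / \<epsilon> ^ N) * norm (gamma_integrand (\<beta> + of_nat N) r)"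
      by simp
  qed auto
qed

text \<open>The part of the small-\<open>r\<close> expansion of \<open>r powr \<beta> * exp (-r)\<close> coming from the terms of
  \<open>exp (-r)\<close> up to degree \<open>N\<close>.\<close>

definition gamma_germ :: "complex \<Rightarrow> nat \<Rightarrow> real \<Rightarrow> complex" where
  "gamma_germ \<beta> N r = (\<Sum>j\<le>N. (-1) ^ j / fact j * of_real r powr (\<beta> + of_nat j))"

text \<open>This is the Taylor remainder of \<open>exp\<close> at \<open>- r\<close>, with constants
  estimated by \<open>r \<le> 1\<close> and \<open>fact N \<ge> 1\<close>.\<close>

lemma norm_gamma_integrand_minus_germ:
  assumes r: "0 < r" "r \<le> 1"
  shows "norm (gamma_integrand \<beta> r - gamma_germ \<beta> N r) \<le> exp 1 * r powr (Re \<beta> + N + 1)"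
proof -
  have "gamma_germ \<beta> N r = of_real r powr \<beta> * (\<Sum>j\<le>N. (- of_real r) ^ j / fact j)"
    unfolding gamma_germ_def sum_distrib_left
    using r by (intro sum.cong) (simp_all add: powr_add power_minus[of "of_real r"] mult_ac)
  then have "gamma_integrand \<beta> r - gamma_germ \<beta> N r =
      of_real r powr \<beta> * (exp (- of_real r) - (\<Sum>j\<le>N. (- of_real r) ^ j / fact j))"
    by (simp add: gamma_integrand_def right_diff_distrib)
  then have "norm (gamma_integrand \<beta> r - gamma_germ \<beta> N r) =
      r powr Re \<beta> * norm (exp (- of_real r) - (\<Sum>j\<le>N. (- complex_of_real r) ^ j / fact j))"
    using r by (simp add: norm_mult norm_powr_real_powr)
  also have "\<dots> \<le> r powr Re \<beta> * (exp r * r ^ Suc N / fact N)"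
    using Taylor_exp[of "- complex_of_real r" N] r by (intro mult_left_mono) auto
  also have "\<dots> \<le> r powr Re \<beta> * (exp 1 * r ^ Suc N / 1)"
    using r by (intro mult_left_mono frac_le mult_mono) (auto simp: fact_ge_1)
  also have "\<dots> = exp 1 * r powr (Re \<beta> + N + 1)"
    using r by (simp add: powr_add powr_realpow)
  finally show ?thesis .
qed

lemma gamma_germ_singular_part:
  obtains \<Omega> c where "finite \<Omega>" "gamma_germ \<beta> N = singular_part \<Omega> c"
proof -
  \<comment> \<open>the index \<open>j\<close> is recovered from the exponent \<open>k = \<beta> + j\<close>\<close>
  define c where "c = (\<lambda>k. let j = nat \<lfloor>Re (k - \<beta>)\<rfloor> in (-1) ^ j / fact j :: complex)"
  have "inj_on (\<lambda>j. \<beta> + of_nat j) {..N}" by (auto intro: inj_onI)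
  then have "gamma_germ \<beta> N = singular_part ((\<lambda>j. \<beta> + of_nat j) ` {..N}) c"
    by (simp add: fun_eq_iff gamma_germ_def singular_part_def sum.reindex c_def)
  then show thesis by (rule that[rotated]) simp
qed

lemma continuous_on_gamma_germ: "A \<subseteq> {0<..} \<Longrightarrow> continuous_on A (gamma_germ \<beta> N)"
  unfolding gamma_germ_def [abs_def] by (intro continuous_intros) auto

text \<open>Enough Taylor terms make the exponent \<open>Re \<beta> + N + 1\<close> nonnegative, so
  the remainder is bounded on the unit interval by \<open>exp 1\<close>.\<close>

lemma gen_integrable_gamma_integrand: "gen_integrable (gamma_integrand \<beta>)"
proof -
  define N where "N = nat \<lceil>\<bar>Re \<beta>\<bar>\<rceil>"
  have N: "Re \<beta> + N + 1 \<ge> 0"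
    unfolding N_def by linarith
  obtain \<Omega> c where \<Omega>: "finite \<Omega>" "gamma_germ \<beta> N = singular_part \<Omega> c"
    by (rule gamma_germ_singular_part)
  have "(\<lambda>r. gamma_integrand \<beta> r - gamma_germ \<beta> N r) absolutely_integrable_on {0<..<1}"
  proof (rule measurable_bounded_by_integrable_imp_absolutely_integrable)
    show "(\<lambda>r. gamma_integrand \<beta> r - gamma_germ \<beta> N r) \<in> borel_measurable (lebesgue_on {0<..<1})"
      by (intro continuous_imp_measurable_on_sets_lebesgue continuous_on_diff
        continuous_on_gamma_integrand continuous_on_gamma_germ) auto
    show "(\<lambda>r::real. exp 1 :: real) integrable_on {0<..<1}"
      unfolding integrable_on_Icc_iff_Ioo[symmetric] by (rule integrable_const_ivl)
    fix r :: real assume r: "r \<in> {0<..<1}"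
    have "norm (gamma_integrand \<beta> r - gamma_germ \<beta> N r) \<le> exp 1 * r powr (Re \<beta> + N + 1)"
      using r by (intro norm_gamma_integrand_minus_germ) auto
    also have "r powr (Re \<beta> + N + 1) \<le> 1"
      using r N by (intro powr_le1) auto
    finally show "norm (gamma_integrand \<beta> r - gamma_germ \<beta> N r) \<le> exp 1" by simp
  qed auto
  with \<Omega> have "gen_expansion (gamma_integrand \<beta>) \<Omega> c"
    by (simp add: gen_expansion_def)
  moreover have "gamma_integrand \<beta> absolutely_integrable_on {1<..}"
    by (rule set_integrable_subset[OF gamma_integrand_tail_integrable[of 1]]) auto
  ultimately show ?thesis
    by (auto simp: gen_integrable_def)
qed

text \<open>Serves for the boundary term of the integration by parts. The assumption keeps 0 out of
  the exponents of the germ, which therefore lies in \<open>log_power_sums\<close>; the remainder is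
  O(r).\<close>

lemma has_finite_part_gamma_integrand:
  assumes "\<And>j::nat. \<beta> + of_nat j \<noteq> 0"
  shows "has_finite_part (gamma_integrand \<beta>) 0"
proof (rule has_finite_partI)
  define N where "N = nat \<lceil>\<bar>Re \<beta>\<bar>\<rceil>"
  have N: "Re \<beta> + N + 1 \<ge> 1"
    unfolding N_def by linarith
  show "gamma_germ \<beta> N \<in> log_power_sums"
    unfolding gamma_germ_def [abs_def]
    by (intro log_power_sums_sum log_power_sums_cmult log_power_sums_powr assms)
  have ev: "\<forall>\<^sub>F r in at_right (0::real). 0 < r \<and> r < 1"
    by (auto simp: eventually_at_right_field intro: exI[of _ 1])
  show "((\<lambda>r. gamma_integrand \<beta> r - gamma_germ \<beta> N r) \<longlongrightarrow> 0) (at_right 0)"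
  proof (rule Lim_null_comparison)
    show "\<forall>\<^sub>F r in at_right 0. norm (gamma_integrand \<beta> r - gamma_germ \<beta> N r) \<le> exp 1 * r"
      using ev
    proof eventually_elim
      case (elim r)
      have "norm (gamma_integrand \<beta> r - gamma_germ \<beta> N r) \<le> exp 1 * r powr (Re \<beta> + N + 1)"
        using elim by (intro norm_gamma_integrand_minus_germ) auto
      also have "r powr (Re \<beta> + N + 1) \<le> r powr 1"
        using elim N by (intro powr_mono') auto
      finally show ?case using elim by simp
    qed
    show "((\<lambda>r. exp 1 * r) \<longlongrightarrow> 0) (at_right (0::real))"
      by (auto intro!: tendsto_eq_intros)
  qed
qed

lemma gamma_integrand_at_top: "(gamma_integrand \<beta> \<longlongrightarrow> 0) at_top"
proof (rule Lim_null_comparison)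
  define N where "N = nat \<lceil>\<bar>Re \<beta>\<bar>\<rceil>"
  have N: "Re \<beta> \<le> N"
    unfolding N_def by linarith
  show "\<forall>\<^sub>F r in at_top. norm (gamma_integrand \<beta> r) \<le> r ^ N / exp r"
    using eventually_ge_at_top[of 1]
  proof eventually_elim
    case (elim r)
    then have "r powr Re \<beta> \<le> r powr N" using N by (intro powr_mono) auto
    with elim show ?case
      by (simp add: norm_gamma_integrand powr_realpow exp_minus field_simps)
  qed
qed (rule tendsto_power_div_exp_0)

section \<open>Integration by parts and the continuation to the left half-plane\<close>

lemma gamma_integrand_has_vector_derivative:
  assumes "r > 0"
  shows "(gamma_integrand (\<beta> + 1) has_vector_derivative
     ((\<beta> + 1) * gamma_integrand \<beta> r - gamma_integrand (\<beta> + 1) r)) (at r within S)"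
proof -
  have "((\<lambda>z. z powr (\<beta> + 1)) has_field_derivative (\<beta> + 1) * complex_of_real r powr (\<beta> + 1 - 1)) (at (of_real r))"
    by (rule has_field_derivative_powr) (use assms in auto)
  moreover have "((\<lambda>z::complex. exp (- z)) has_field_derivative - exp (- of_real r)) (at (of_real r))"
    by (auto intro!: derivative_eq_intros)
  ultimately have "((\<lambda>z. z powr (\<beta> + 1) * exp (- z)) has_field_derivative
      (\<beta> + 1) * complex_of_real r powr (\<beta> + 1 - 1) * exp (- of_real r)
        + - exp (- of_real r) * complex_of_real r powr (\<beta> + 1)) (at (of_real r))"
    by (rule DERIV_mult)
  from has_vector_derivative_real_field[OF this]
  show ?thesis by (simp add: gamma_integrand_def [abs_def] mult_ac)
qed

text \<open>The derivative \<open>h\<close> of \<open>gamma_integrand (\<beta> + 1)\<close>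
  integrates to minus the boundary value at \<open>\<epsilon>\<close>, since that function vanishes
  at infinity.\<close>

lemma gamma_integrand_tail_by_parts:
  assumes \<epsilon>: "\<epsilon> > 0"
  shows "(\<beta> + 1) * integral {\<epsilon>..} (gamma_integrand \<beta>) =
    integral {\<epsilon>..} (gamma_integrand (\<beta> + 1)) - gamma_integrand (\<beta> + 1) \<epsilon>"
proof -
  define h where "h = (\<lambda>r. (\<beta> + 1) * gamma_integrand \<beta> r - gamma_integrand (\<beta> + 1) r)"
  note i = gamma_integrand_tail_integrable[OF \<epsilon>]
  have h: "h absolutely_integrable_on {\<epsilon>..}"
    unfolding h_def by (intro set_integral_diff(1) set_integrable_mult_right i)
  have "((\<lambda>b. LINT r:{\<epsilon>..b}|lebesgue. h r) \<longlongrightarrow> (LINT r:{\<epsilon>..}|lebesgue. h r)) at_top"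
    by (rule tendsto_set_lebesgue_integral_at_top[OF _ h]) auto
  moreover have "\<forall>\<^sub>F b in at_top. (LINT r:{\<epsilon>..b}|lebesgue. h r) =
      gamma_integrand (\<beta> + 1) b - gamma_integrand (\<beta> + 1) \<epsilon>"
    using eventually_ge_at_top[of \<epsilon>]
  proof eventually_elim
    case (elim b)
    have "h absolutely_integrable_on {\<epsilon>..b}"
      by (rule set_integrable_subset[OF h]) auto
    then have "(LINT r:{\<epsilon>..b}|lebesgue. h r) = integral {\<epsilon>..b} h"
      by (rule set_lebesgue_integral_eq_integral)
    also have "(h has_integral (gamma_integrand (\<beta> + 1) b - gamma_integrand (\<beta> + 1) \<epsilon>)) {\<epsilon>..b}"
      unfolding h_def using elim \<epsilon>
      by (intro fundamental_theorem_of_calculus gamma_integrand_has_vector_derivative) auto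
    then have "integral {\<epsilon>..b} h = gamma_integrand (\<beta> + 1) b - gamma_integrand (\<beta> + 1) \<epsilon>"
      by (rule integral_unique)
    finally show ?case .
  qed
  ultimately have "((\<lambda>b. gamma_integrand (\<beta> + 1) b - gamma_integrand (\<beta> + 1) \<epsilon>) \<longlongrightarrow>
      (LINT r:{\<epsilon>..}|lebesgue. h r)) at_top"
    by (rule Lim_transform_eventually)
  moreover have "((\<lambda>b. gamma_integrand (\<beta> + 1) b - gamma_integrand (\<beta> + 1) \<epsilon>) \<longlongrightarrow>
      0 - gamma_integrand (\<beta> + 1) \<epsilon>) at_top"
    by (intro tendsto_diff tendsto_const gamma_integrand_at_top)
  ultimately have "(LINT r:{\<epsilon>..}|lebesgue. h r) = 0 - gamma_integrand (\<beta> + 1) \<epsilon>"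
    by (rule tendsto_unique[OF trivial_limit_at_top_linorder])
  then have "integral {\<epsilon>..} h = - gamma_integrand (\<beta> + 1) \<epsilon>"
    using set_lebesgue_integral_eq_integral(2)[OF h] by simp
  moreover have "integral {\<epsilon>..} h =
      (\<beta> + 1) * integral {\<epsilon>..} (gamma_integrand \<beta>) - integral {\<epsilon>..} (gamma_integrand (\<beta> + 1))"
    unfolding h_def using i
    by (subst integral_diff) (auto simp: absolutely_integrable_on_def intro: integrable_on_mult_right)
  ultimately show ?thesis
    by (simp add: algebra_simps)
qed

text \<open>Here Euler's integral converges, and the tail is \<open>Gamma (\<beta> + 1)\<close>
  minus an integral over \<open>{0..\<epsilon>}\<close> that tends to 0. The finite part is thus an
  ordinary limit.\<close>

lemma gamma_tail_finite_part_of_pos_Re: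
  assumes "Re (\<beta> + 1) > 0"
  shows "has_finite_part (\<lambda>\<epsilon>. integral {\<epsilon>..} (gamma_integrand \<beta>)) (Gamma (\<beta> + 1))"
proof (rule has_finite_part_cong)
  have G: "(gamma_integrand \<beta> has_integral Gamma (\<beta> + 1)) {0..}"
    using Gamma_integral_complex[OF assms] unfolding gamma_integrand_eq_divide [abs_def] .
  have i: "gamma_integrand \<beta> integrable_on {0..1}"
    by (rule integrable_on_subinterval[of _ "{0..}"]) (use G in auto)
  have "continuous_on {0..1} (\<lambda>\<epsilon>. integral {0..\<epsilon>} (gamma_integrand \<beta>))"
    by (rule indefinite_integral_continuous_1[OF i])
  then have "((\<lambda>\<epsilon>. integral {0..\<epsilon>} (gamma_integrand \<beta>)) \<longlongrightarrow> integral {0..0} (gamma_integrand \<beta>)) (at 0 within {0..1})"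
    unfolding continuous_on_def by (metis atLeastAtMost_iff order_refl zero_le_one)
  then have "((\<lambda>\<epsilon>. integral {0..\<epsilon>} (gamma_integrand \<beta>)) \<longlongrightarrow> 0) (at_right 0)"
    by (simp add: at_within_Icc_at_right)
  from tendsto_diff[OF tendsto_const this]
  show "has_finite_part (\<lambda>\<epsilon>. Gamma (\<beta> + 1) - integral {0..\<epsilon>} (gamma_integrand \<beta>)) (Gamma (\<beta> + 1))"
    by (intro has_finite_part_tendsto) simp
  fix \<epsilon> :: real assume \<epsilon>: "0 < \<epsilon>" "\<epsilon> < 1"
  have u: "{0..\<epsilon>} \<union> {\<epsilon>..} = {0..}" using \<epsilon> by auto
  have n: "{0..\<epsilon>} \<inter> {\<epsilon>..} = {\<epsilon>}" using \<epsilon> by auto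
  have "integral ({0..\<epsilon>} \<union> {\<epsilon>..}) (gamma_integrand \<beta>) =
      integral {0..\<epsilon>} (gamma_integrand \<beta>) + integral {\<epsilon>..} (gamma_integrand \<beta>)"
  proof (rule integral_Un)
    show "gamma_integrand \<beta> integrable_on {0..\<epsilon>}"
      by (rule integrable_on_subinterval[OF i]) (use \<epsilon> in auto)
    show "gamma_integrand \<beta> integrable_on {\<epsilon>..}"
      using gamma_integrand_tail_integrable[OF \<epsilon>(1)] by (simp add: absolutely_integrable_on_def)
  qed (simp only: n negligible_sing)
  with integral_unique[OF G]
  show "Gamma (\<beta> + 1) - integral {0..\<epsilon>} (gamma_integrand \<beta>) = integral {\<epsilon>..} (gamma_integrand \<beta>)"
    by (simp add: u)
qed

lemma gamma_tail_finite_part: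
  assumes "\<And>j::nat. \<beta> + 1 + of_nat j \<noteq> 0"
  shows "has_finite_part (\<lambda>\<epsilon>. integral {\<epsilon>..} (gamma_integrand \<beta>)) (Gamma (\<beta> + 1))"
proof -
  \<comment> \<open>\<open>n\<close> bounds the number of unit shifts of \<open>\<beta>\<close> that
    lead into the half-plane of convergence.\<close>
  have "has_finite_part (\<lambda>\<epsilon>. integral {\<epsilon>..} (gamma_integrand \<beta>)) (Gamma (\<beta> + 1))"
    if "Re (\<beta> + 1) > - real n" "\<And>j::nat. \<beta> + 1 + of_nat j \<noteq> 0" for n
    using that
  proof (induction n arbitrary: \<beta>)
    case 0
    then show ?case by (intro gamma_tail_finite_part_of_pos_Re) simp
  next
    case (Suc n)
    have nz: "\<beta> + 1 + 1 + of_nat j \<noteq> 0" for j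
      using Suc.prems(2)[of "Suc j"] by (simp add: add_ac)
    have b: "\<beta> + 1 \<noteq> 0" using Suc.prems(2)[of 0] by simp
    have "has_finite_part (\<lambda>\<epsilon>. integral {\<epsilon>..} (gamma_integrand (\<beta> + 1))) (Gamma (\<beta> + 1 + 1))"
      using Suc.prems(1) by (intro Suc.IH nz) simp
    \<comment> \<open>The boundary term has finite part 0, since the exponents
      \<open>\<beta> + 1 + of_nat j\<close> of its expansion are all nonzero. So the finite parts
      obey the functional equation of Gamma.\<close>
    from has_finite_part_cmult[OF has_finite_part_add[OF this
          has_finite_part_cmult[OF has_finite_part_gamma_integrand[OF Suc.prems(2)], of "-1"]], of "1 / (\<beta> + 1)"]
    have "has_finite_part (\<lambda>\<epsilon>. 1 / (\<beta> + 1) * (integral {\<epsilon>..} (gamma_integrand (\<beta> + 1)) + - 1 * gamma_integrand (\<beta> + 1) \<epsilon>))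
       (1 / (\<beta> + 1) * (Gamma (\<beta> + 1 + 1) + - 1 * 0))" .
    moreover have "1 / (\<beta> + 1) * (Gamma (\<beta> + 1 + 1) + - 1 * 0) = Gamma (\<beta> + 1)"
      using Gamma_plus1[OF add_of_nat_nonzero_imp_notin_nonpos_Ints[OF Suc.prems(2)]] b
      by (simp add: field_simps)
    ultimately have fp: "has_finite_part (\<lambda>\<epsilon>. 1 / (\<beta> + 1) * (integral {\<epsilon>..} (gamma_integrand (\<beta> + 1)) + - 1 * gamma_integrand (\<beta> + 1) \<epsilon>))
       (Gamma (\<beta> + 1))" by simp
    show ?case
    proof (rule has_finite_part_cong[OF _ fp])
      fix \<epsilon> :: real assume "0 < \<epsilon>" "\<epsilon> < 1"
      from gamma_integrand_tail_by_parts[OF this(1), of \<beta>] b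
      show "1 / (\<beta> + 1) * (integral {\<epsilon>..} (gamma_integrand (\<beta> + 1)) + - 1 * gamma_integrand (\<beta> + 1) \<epsilon>) =
        integral {\<epsilon>..} (gamma_integrand \<beta>)"
        by (simp add: divide_eq_eq mult.commute)
    qed
  qed
  moreover obtain n where "- Re (\<beta> + 1) < real n"
    using reals_Archimedean2 by blast
  ultimately show ?thesis
    using assms by (metis minus_less_iff)
qed

section \<open>The generalized Euler integral and orthogonality\<close>

lemma has_gen_integral_gamma_integrand:
  assumes "\<And>j::nat. \<beta> + 1 + of_nat j \<noteq> 0"
  shows "has_gen_integral (gamma_integrand \<beta>) (Gamma (\<beta> + 1))"
  by (simp add: has_gen_integral_def gen_integrable_gamma_integrand gamma_tail_finite_part assms)

text \<open>Expansion into powers reduces the integral to values of Gamma at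
  \<open>\<alpha> + of_nat i + 1\<close>. Each is a Pochhammer multiple of
  \<open>Gamma (\<alpha> + 1)\<close>, and \<open>sum_Laguerre_coeff\<close> evaluates the resulting
  double sum.\<close>

lemma has_gen_integral_Laguerre_mult:
  assumes "\<And>j::nat. \<alpha> + 1 + of_nat j \<noteq> 0"
  shows "has_gen_integral (\<lambda>x. Laguerre \<alpha> m (of_real x) * Laguerre \<alpha> n (of_real x) *
                        of_real x powr \<alpha> * exp (- of_real x))
    (Gamma (1 + of_nat n + \<alpha>) / fact n * (if m = n then 1 else 0))"
proof -
  have nz: "\<alpha> + of_nat i + 1 + of_nat j \<noteq> 0" for i j
    using assms[of "i + j"] by (simp add: add_ac)
  \<comment> \<open>Away from its poles \<open>Gamma\<close> is nonzero, so the quotient in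
    \<open>pochhammer_Gamma\<close> can be cleared.\<close>
  have np: "\<alpha> + 1 \<notin> \<int>\<^sub>\<le>\<^sub>0"
    by (rule add_of_nat_nonzero_imp_notin_nonpos_Ints[OF assms])
  have G: "Gamma (\<alpha> + of_nat i + 1) = Gamma (\<alpha> + 1) * pochhammer (\<alpha> + 1) i" for i
    using pochhammer_Gamma[OF np, of i] np by (simp add: Gamma_eq_zero_iff add_ac)
  have eq: "(\<lambda>x. \<Sum>j=0..m. \<Sum>k=0..n. Laguerre_coeff \<alpha> m j * Laguerre_coeff \<alpha> n k *
      gamma_integrand (\<alpha> + of_nat (j + k)) x) =
    (\<lambda>x. Laguerre \<alpha> m (of_real x) * Laguerre \<alpha> n (of_real x) * of_real x powr \<alpha> * exp (- of_real x))"
  proof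
    fix x :: real
    have "(\<Sum>j=0..m. \<Sum>k=0..n. Laguerre_coeff \<alpha> m j * Laguerre_coeff \<alpha> n k *
        gamma_integrand (\<alpha> + of_nat (j + k)) x) =
      (\<Sum>j=0..m. \<Sum>k=0..n. (Laguerre_coeff \<alpha> m j * of_real x ^ j) * (Laguerre_coeff \<alpha> n k * of_real x ^ k)) *
        gamma_integrand \<alpha> x"
      unfolding gamma_integrand_add_nat power_add sum_distrib_right by (simp only: mult_ac)
    also have "\<dots> = Laguerre \<alpha> m (of_real x) * Laguerre \<alpha> n (of_real x) * gamma_integrand \<alpha> x"
      unfolding Laguerre_eq_sum_coeff sum_product ..
    finally show "(\<Sum>j=0..m. \<Sum>k=0..n. Laguerre_coeff \<alpha> m j * Laguerre_coeff \<alpha> n k *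
        gamma_integrand (\<alpha> + of_nat (j + k)) x) =
      Laguerre \<alpha> m (of_real x) * Laguerre \<alpha> n (of_real x) * of_real x powr \<alpha> * exp (- of_real x)"
      by (simp add: gamma_integrand_def mult.assoc)
  qed
  have "has_gen_integral (\<lambda>x. \<Sum>j=0..m. \<Sum>k=0..n. Laguerre_coeff \<alpha> m j * Laguerre_coeff \<alpha> n k *
      gamma_integrand (\<alpha> + of_nat (j + k)) x)
    (\<Sum>j=0..m. \<Sum>k=0..n. Laguerre_coeff \<alpha> m j * Laguerre_coeff \<alpha> n k * Gamma (\<alpha> + of_nat (j + k) + 1))"
    by (intro has_gen_integral_sum has_gen_integral_cmult has_gen_integral_gamma_integrand nz)
  moreover have "(\<Sum>j=0..m. \<Sum>k=0..n. Laguerre_coeff \<alpha> m j * Laguerre_coeff \<alpha> n k * Gamma (\<alpha> + of_nat (j + k) + 1)) =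
     Gamma (\<alpha> + 1) * (\<Sum>j=0..m. \<Sum>k=0..n. Laguerre_coeff \<alpha> m j * Laguerre_coeff \<alpha> n k * pochhammer (\<alpha> + 1) (j + k))"
    unfolding G sum_distrib_left by (intro sum.cong refl) (simp only: mult_ac)
  moreover have "\<dots> = Gamma (1 + of_nat n + \<alpha>) / fact n * (if m = n then 1 else 0)"
    unfolding sum_Laguerre_coeff using G[of n] by (simp add: add_ac)
  ultimately show ?thesis unfolding eq by simp
qed

theorem theorem3p2:
  fixes \<alpha> :: complex
  assumes "\<forall>k::nat. k \<ge> 1 \<longrightarrow> \<alpha> \<noteq> - of_nat k"
  shows "\<forall>m n :: nat.
    gen_integrable (\<lambda>x. Laguerre \<alpha> m (of_real x) * Laguerre \<alpha> n (of_real x) *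
                        of_real x powr \<alpha> * exp (- of_real x)) \<and>
    gen_integral (\<lambda>x. Laguerre \<alpha> m (of_real x) * Laguerre \<alpha> n (of_real x) *
                        of_real x powr \<alpha> * exp (- of_real x))
      = Gamma (1 + of_nat n + \<alpha>) / fact n * (if m = n then 1 else 0)"
proof (intro allI)
  fix m n
  have "\<alpha> + 1 + of_nat j \<noteq> 0" for j
  proof
    assume "\<alpha> + 1 + of_nat j = 0"
    then have "\<alpha> = - of_nat (Suc j)"
      unfolding eq_neg_iff_add_eq_0 by (simp add: add_ac)
    with assms[rule_format, of "Suc j"] show False by simp
  qed
  from has_gen_integral_Laguerre_mult[OF this, of m n]
  show "gen_integrable (\<lambda>x. Laguerre \<alpha> m (of_real x) * Laguerre \<alpha> n (of_real x) *
                        of_real x powr \<alpha> * exp (- of_real x)) \<and>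
    gen_integral (\<lambda>x. Laguerre \<alpha> m (of_real x) * Laguerre \<alpha> n (of_real x) *
                        of_real x powr \<alpha> * exp (- of_real x))
      = Gamma (1 + of_nat n + \<alpha>) / fact n * (if m = n then 1 else 0)"
    using has_gen_integral_imp_gen_integral unfolding has_gen_integral_def by blast
qed

end
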